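(* Let $\mathcal{K}$ be any nonempty finite set of $(1,1)$- or $(2,1)$-intervals of $\mathbb{R}^2$, and let $\mathcal{J}_1,\mathcal{J}_2$ be any two $n$-element (ordered) sets of $(1,1)$- or $(2,1)$-intervals of $\mathbb{R}^2$, for some positive integer $n$. Then $$|\hat d(\mathcal{K},\mathcal{J}_1)-\hat d(\mathcal{K},\mathcal{J}_2)|\le 2\cdot\min_\pi\|\mathbb{v}_{\pi(\mathcal{J}_1)}-\mathbb{v}_{\mathcal{J}_2}\|_\infty,$$ where the minimum is taken over all permutations $\pi$ of $\mathcal{J}_1$ (i.e. over all orderings of the elements of $\mathcal{J}_1$).
   Context: $\mathbb{R}^2$ carries the product partial order. An interval of $\mathbb{R}^2$ is a nonempty subset $I$ that is convex ($p,q\in I$, $p\le r\le q$ imply $r\in I$) and connected (any two elements are joined by a finite sequence in $I$ whose consecutive terms are comparable). $\min(I)$ and $\max(I)$ are the sets of minimal and maximal elements of $I$. A $(p,q)$-interval is an interval with exactly $p$ minimal points and exactly $q$ maximal points, and it is understood to be determined by them: $I=\{z\in\mathbb{R}^2:\exists u\in\min(I),\exists v\in\max(I),\ u\le z\le v\}$. For $\epsilon\ge0$, $I^\epsilon=\{q\in\mathbb{R}^2:\exists p\in I,\ \|p-q\|_\infty\le\epsilon\}$. An $\epsilon$-correspondence between nonempty sets of intervals $\mathcal{I},\mathcal{J}$ is a subset $\mathcal{R}\subset\mathcal{I}\times\mathcal{J}$ with surjective projections to both factors such that $J\subset I^\epsilon$ and $I\subset J^\epsilon$ for all $(I,J)\in\mathcal{R}$.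 Define $\hat d(\mathcal{I},\mathcal{J}):=\inf\{\epsilon>0:\text{there exists an }\epsilon\text{-correspondence between }\mathcal{I}\text{ and }\mathcal{J}\}$. The embedding $\mathbf{v}_I=(x,y,a,b,c,d)\in\mathbb{R}^6$: a $(2,1)$-interval with minimal points $(\xi_1,\eta_1),(\xi_2,\eta_2)$, $\xi_1<\xi_2$, $\eta_1>\eta_2$, and maximal point $(X,Y)$ has $\mathbf{v}_I=(\xi_2,\ \eta_1,\ Y-\eta_1,\ \xi_2-\xi_1,\ \eta_1-\eta_2,\ X-\xi_2)$; thus its minimal points are $(x-b,y)$ and $(x,y-c)$ and its maximal point is $(x+d,y+a)$. A $(1,1)$-interval with minimal point $(\xi,\eta)$ and maximal point $(X,Y)$ has $\mathbf{v}_I=(\xi,\eta,Y-\eta,0,0,X-\xi)$. For an ordered $n$-set $\mathcal{J}=(J_1,\dots,J_n)$, $\mathbb{v}_{\mathcal{J}}=(\mathbf{v}_{J_1}|\cdots|\mathbf{v}_{J_n})\in\mathbb{R}^{6n}$ is the concatenation, and $\pi(\mathcal{J})$ is the reordering of $\mathcal{J}$ by $\pi$. *)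

theory Defs
  imports "HOL-Analysis.Analysis" "HOL-Combinatorics.Permutations"
begin

text \<open>
  The plane is \<^typ>\<open>real \<times> real\<close>; \<open>\<le>\<close> on it is the product order (HOL-Library.Product_Order) and
  \<^const>\<open>infnorm\<close> is the maximum norm.
\<close>

definition minimal_points :: "'a::order set \<Rightarrow> 'a set" where
  "minimal_points I = {p \<in> I. \<not> (\<exists>q\<in>I. q < p)}"

definition maximal_points :: "'a::order set \<Rightarrow> 'a set" where
  "maximal_points I = {p \<in> I. \<not> (\<exists>q\<in>I. p < q)}"

definition poset_convex :: "'a::order set \<Rightarrow> bool" where
  "poset_convex I \<longleftrightarrow> (\<forall>p\<in>I. \<forall>q\<in>I. \<forall>r. p \<le> r \<and> r \<le> q \<longrightarrow> r \<in> I)"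

definition poset_connected :: "'a::order set \<Rightarrow> bool" where
  "poset_connected I \<longleftrightarrow>
     (\<forall>p\<in>I. \<forall>q\<in>I. (p, q) \<in> {(u, v). u \<in> I \<and> v \<in> I \<and> (u \<le> v \<or> v \<le> u)}\<^sup>*)"

definition poset_interval :: "'a::order set \<Rightarrow> bool" where
  "poset_interval I \<longleftrightarrow> I \<noteq> {} \<and> poset_convex I \<and> poset_connected I"

definition pq_interval :: "nat \<Rightarrow> nat \<Rightarrow> (real \<times> real) set \<Rightarrow> bool" where
  "pq_interval p q I \<longleftrightarrow> poset_interval I \<and>
     finite (minimal_points I) \<and> card (minimal_points I) = p \<and>
     finite (maximal_points I) \<and> card (maximal_points I) = q \<and>
     I = {z. \<exists>u\<in>minimal_points I. \<exists>v\<in>maximal_points I. u \<le> z \<and> z \<le> v}"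

definition thickening :: "real \<Rightarrow> (real \<times> real) set \<Rightarrow> (real \<times> real) set" where
  "thickening \<epsilon> I = {q. \<exists>p\<in>I. infnorm (p - q) \<le> \<epsilon>}"

definition is_correspondence ::
  "real \<Rightarrow> (real \<times> real) set set \<Rightarrow> (real \<times> real) set set
     \<Rightarrow> ((real \<times> real) set \<times> (real \<times> real) set) set \<Rightarrow> bool" where
  "is_correspondence \<epsilon> \<I> \<J> R \<longleftrightarrow>
     R \<subseteq> \<I> \<times> \<J> \<and> fst ` R = \<I> \<and> snd ` R = \<J> \<and>
     (\<forall>(I, J)\<in>R. J \<subseteq> thickening \<epsilon> I \<and> I \<subseteq> thickening \<epsilon> J)"

text \<open>
  The infimum is taken in the reals, so the definition is meaningful only if some correspondence
  exists. This is so for finite nonempty sets of bounded intervals, in particular of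
  \<open>(p,q)\<close>-intervals (lemmas \<open>correspondence_exists\<close> and \<open>bounded_pq_interval\<close> below).
\<close>

definition d_hat :: "(real \<times> real) set set \<Rightarrow> (real \<times> real) set set \<Rightarrow> real" where
  "d_hat \<I> \<J> = Inf {\<epsilon>. \<epsilon> > 0 \<and> (\<exists>R. is_correspondence \<epsilon> \<I> \<J> R)}"

text \<open>
  Vectors are represented as real lists: the embedding of a single interval has length 6,
  that of \<open>n\<close> intervals has length \<open>6n\<close>.  The definite description is unspecified
  on sets that are neither \<open>(1,1)\<close>- nor \<open>(2,1)\<close>-intervals.
\<close>

definition embedding :: "(real \<times> real) set \<Rightarrow> real list" where
  "embedding I = (THE v.
     (\<exists>\<xi> \<eta> X Y. pq_interval 1 1 I \<and>
        minimal_points I = {(\<xi>, \<eta>)} \<and> maximal_points I = {(X, Y)} \<and>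
        v = [\<xi>, \<eta>, Y - \<eta>, 0, 0, X - \<xi>]) \<or>
     (\<exists>\<xi>\<^sub>1 \<eta>\<^sub>1 \<xi>\<^sub>2 \<eta>\<^sub>2 X Y. pq_interval 2 1 I \<and> \<xi>\<^sub>1 < \<xi>\<^sub>2 \<and> \<eta>\<^sub>1 > \<eta>\<^sub>2 \<and>
        minimal_points I = {(\<xi>\<^sub>1, \<eta>\<^sub>1), (\<xi>\<^sub>2, \<eta>\<^sub>2)} \<and> maximal_points I = {(X, Y)} \<and>
        v = [\<xi>\<^sub>2, \<eta>\<^sub>1, Y - \<eta>\<^sub>1, \<xi>\<^sub>2 - \<xi>\<^sub>1, \<eta>\<^sub>1 - \<eta>\<^sub>2, X - \<xi>\<^sub>2]))"

definition concat_embedding :: "(real \<times> real) set list \<Rightarrow> real list" where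
  "concat_embedding Js = concat (map embedding Js)"

definition linf_norm :: "real list \<Rightarrow> real" where
  "linf_norm v = Max (abs ` set v)"

lemma embedding_11:
  assumes "pq_interval 1 1 I" "minimal_points I = {(\<xi>, \<eta>)}" "maximal_points I = {(X, Y)}"
  shows "embedding I = [\<xi>, \<eta>, Y - \<eta>, 0, 0, X - \<xi>]"
proof -
  have "\<not> pq_interval 2 1 I" using assms(1) by (simp add: pq_interval_def)
  then show ?thesis unfolding embedding_def using assms by (intro the_equality) auto
qed

lemma embedding_21:
  assumes "pq_interval 2 1 I" "\<xi>\<^sub>1 < \<xi>\<^sub>2" "\<eta>\<^sub>1 > \<eta>\<^sub>2"
    and "minimal_points I = {(\<xi>\<^sub>1, \<eta>\<^sub>1), (\<xi>\<^sub>2, \<eta>\<^sub>2)}" "maximal_points I = {(X, Y)}"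
  shows "embedding I = [\<xi>\<^sub>2, \<eta>\<^sub>1, Y - \<eta>\<^sub>1, \<xi>\<^sub>2 - \<xi>\<^sub>1, \<eta>\<^sub>1 - \<eta>\<^sub>2, X - \<xi>\<^sub>2]"
proof -
  have "\<not> pq_interval 1 1 I" using assms(1) by (simp add: pq_interval_def)
  then show ?thesis
    unfolding embedding_def using assms by (intro the_equality) (auto simp: doubleton_eq_iff)
qed

lemma bounded_pq_interval:
  assumes "pq_interval p q I"
  shows "bounded I"
proof -
  have "bounded (\<Union>u\<in>minimal_points I. \<Union>v\<in>maximal_points I. {u..v})"
    using assms unfolding pq_interval_def by (intro bounded_UN ballI bounded_closed_interval) simp_all
  moreover have "I \<subseteq> (\<Union>u\<in>minimal_points I. \<Union>v\<in>maximal_points I. {u..v})"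
  proof
    fix z assume "z \<in> I"
    moreover have "I = {z. \<exists>u\<in>minimal_points I. \<exists>v\<in>maximal_points I. u \<le> z \<and> z \<le> v}"
      using assms unfolding pq_interval_def by blast
    ultimately have "\<exists>u\<in>minimal_points I. \<exists>v\<in>maximal_points I. u \<le> z \<and> z \<le> v"
      by blast
    then show "z \<in> (\<Union>u\<in>minimal_points I. \<Union>v\<in>maximal_points I. {u..v})"
      by fastforce
  qed
  ultimately show ?thesis by (rule bounded_subset)
qed

lemma correspondence_exists:
  assumes "finite \<I>" "\<I> \<noteq> {}" "finite \<J>" "\<J> \<noteq> {}"
    and "\<forall>I\<in>\<I> \<union> \<J>. I \<noteq> {} \<and> bounded I"
  shows "\<exists>\<epsilon>>0. is_correspondence \<epsilon> \<I> \<J> (\<I> \<times> \<J>)"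
proof -
  have "bounded (\<Union>(\<I> \<union> \<J>))" using assms by (intro bounded_Union) auto
  then obtain B where B: "B > 0" "\<forall>x\<in>\<Union>(\<I> \<union> \<J>). norm x \<le> B"
    by (auto simp: bounded_pos)
  have d: "infnorm (x - y) \<le> 2 * B" if "x \<in> \<Union>(\<I> \<union> \<J>)" "y \<in> \<Union>(\<I> \<union> \<J>)" for x y
  proof -
    have "norm x \<le> B" "norm y \<le> B" using that B(2) by blast+
    then show ?thesis using infnorm_le_norm[of "x - y"] norm_triangle_ineq4[of x y] by linarith
  qed
  have t: "L \<subseteq> thickening (2 * B) M" if L: "L \<in> \<I> \<union> \<J>" and M: "M \<in> \<I> \<union> \<J>" for L M
  proof
    fix y assume y: "y \<in> L"
    have "M \<noteq> {}" using bspec[OF assms(5) M] by (rule conjunct1)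
    then obtain x where x: "x \<in> M" by (meson ex_in_conv)
    have "infnorm (x - y) \<le> 2 * B"
      using UnionI[OF M x] UnionI[OF L y] by (rule d)
    with x show "y \<in> thickening (2 * B) M"
      unfolding thickening_def by (intro CollectI bexI)
  qed
  have "fst ` (\<I> \<times> \<J>) = \<I>" "snd ` (\<I> \<times> \<J>) = \<J>"
    using assms(2,4) by (simp_all only: fst_image_times snd_image_times if_False)
  moreover have "\<forall>(I, J)\<in>\<I> \<times> \<J>. J \<subseteq> thickening (2 * B) I \<and> I \<subseteq> thickening (2 * B) J"
  proof (intro ballI, clarify)
    fix I J assume "I \<in> \<I>" "J \<in> \<J>"
    then have "I \<in> \<I> \<union> \<J>" "J \<in> \<I> \<union> \<J>" by simp_all
    then show "J \<subseteq> thickening (2 * B) I \<and> I \<subseteq> thickening (2 * B) J"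
      by (intro conjI t)
  qed
  ultimately have "is_correspondence (2 * B) \<I> \<J> (\<I> \<times> \<J>)"
    unfolding is_correspondence_def by (intro conjI subset_refl)
  moreover have "2 * B > 0" using B(1) by simp
  ultimately show ?thesis by (intro exI conjI)
qed

end

theory Submission
  imports Defs
begin

text \<open>
  The embedding coordinates \<open>(x, y, a, b, c, d)\<close> describe an interval as a union of two closed
  boxes \<open>[u\<^sub>1, v] \<union> [u\<^sub>2, v]\<close> whose corners \<open>u\<^sub>1 = (x - b, y)\<close>, \<open>u\<^sub>2 = (x, y - c)\<close> and
  \<open>v = (x + d, y + a)\<close> have components built from at most two coordinates each; a \<open>(1,1)\<close>-interval is the
  degenerate case \<open>b = c = 0\<close>, in which the two boxes coincide, so both kinds of interval are treated
  alike (lemma \<open>two_box_form\<close>). Changing each coordinate by at most \<open>\<delta>\<close> therefore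
  moves each corner by at most \<open>2\<delta>\<close> in the maximum norm. Clamping a point to a box whose corners
  have moved by at most \<open>e\<close> moves the point by at most \<open>e\<close>, so two intervals whose embeddings
  differ by at most \<open>\<delta>\<close> lie in each other's \<open>2\<delta>\<close>-thickening (lemma \<open>subset_thickening_embedding\<close>).
  This is where the factor \<open>2\<close> comes from.

  An ordering of \<open>\<J>\<^sub>1\<close> that attains the minimum thus matches \<open>\<J>\<^sub>1\<close> with \<open>\<J>\<^sub>2\<close> by a
  \<open>2\<delta>\<close>-correspondence. Correspondences compose, with errors adding up, so composing with this
  one turns every \<open>\<epsilon>\<close>-correspondence between \<open>\<K>\<close> and one of the two families into an
  \<open>(\<epsilon> + 2\<delta>)\<close>-correspondence between \<open>\<K>\<close> and the other, and the infima differ by at most \<open>2\<delta>\<close>.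
\<close>

section \<open>Thickenings and composition of correspondences\<close>

lemma infnorm_Pair_le:
  fixes s t :: real
  assumes "\<bar>s\<bar> \<le> e" "\<bar>t\<bar> \<le> e"
  shows "infnorm (s, t) \<le> e"
  using assms by (auto simp: infnorm_Max Basis_prod_def)

lemma thickening_mono:
  "A \<subseteq> B \<Longrightarrow> thickening e A \<subseteq> thickening e B"
  by (auto simp: thickening_def)

lemma thickening_trans:
  assumes "A \<subseteq> thickening s B" "B \<subseteq> thickening t C"
  shows "A \<subseteq> thickening (s + t) C"
proof
  fix z assume "z \<in> A"
  then obtain p where p: "p \<in> B" "infnorm (p - z) \<le> s"
    using assms(1) by (auto simp: thickening_def)
  then obtain q where q: "q \<in> C" "infnorm (q - p) \<le> t"
    using assms(2) by (auto simp: thickening_def)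
  have "infnorm ((q - p) + (p - z)) \<le> infnorm (q - p) + infnorm (p - z)"
    by (rule infnorm_triangle)
  then have "infnorm (q - z) \<le> s + t" using p q by simp
  then show "z \<in> thickening (s + t) C" using q by (auto simp: thickening_def)
qed

lemma is_correspondence_converse:
  assumes "is_correspondence e A B R"
  shows "is_correspondence e B A (R\<inverse>)"
proof -
  have "fst ` (R\<inverse>) = snd ` R" "snd ` (R\<inverse>) = fst ` R" by force+
  then show ?thesis using assms by (auto simp: is_correspondence_def)
qed

lemma is_correspondence_relcomp:
  assumes R: "is_correspondence s A B R" and S: "is_correspondence t B C S"
  shows "is_correspondence (s + t) A C (R O S)"
  unfolding is_correspondence_def
proof (intro conjI)
  note R' = R[unfolded is_correspondence_def] and S' = S[unfolded is_correspondence_def]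
  show sub: "R O S \<subseteq> A \<times> C" using R' S' by blast
  have "a \<in> fst ` (R O S)" if a: "a \<in> A" for a
  proof -
    obtain b where ab: "(a, b) \<in> R" using R' a by force
    then have "b \<in> fst ` S" using R' S' by auto
    then obtain c where "(b, c) \<in> S" by auto
    with ab show ?thesis by force
  qed
  then show "fst ` (R O S) = A" using sub by auto
  have "c \<in> snd ` (R O S)" if c: "c \<in> C" for c
  proof -
    obtain b where bc: "(b, c) \<in> S" using S' c by force
    then have "b \<in> snd ` R" using R' S' by auto
    then obtain a where "(a, b) \<in> R" by auto
    with bc show ?thesis by force
  qed
  then show "snd ` (R O S) = C" using sub by auto
  show "\<forall>(I, J)\<in>R O S. J \<subseteq> thickening (s + t) I \<and> I \<subseteq> thickening (s + t) J"
  proof (clarify, intro conjI)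
    fix I L J assume "(I, L) \<in> R" "(L, J) \<in> S"
    then have "L \<subseteq> thickening s I" "I \<subseteq> thickening s L" "J \<subseteq> thickening t L" "L \<subseteq> thickening t J"
      using R' S' by auto
    then show "J \<subseteq> thickening (s + t) I" "I \<subseteq> thickening (s + t) J"
      using thickening_trans[of J t L s I] thickening_trans[of I s L t J]
      by (simp_all add: add.commute)
  qed
qed

text \<open>
  The assumption that some correspondence between \<open>\<K>\<close> and \<open>A\<close> exists keeps the first infimum
  from being taken over the empty set, where its value is unspecified.
\<close>

lemma d_hat_le_add:
  assumes ex: "\<exists>\<epsilon>>0. \<exists>R. is_correspondence \<epsilon> \<K> A R"
    and S: "is_correspondence t A B S" and t: "t \<ge> 0"
  shows "d_hat \<K> B \<le> d_hat \<K> A + t"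
proof -
  have "d_hat \<K> B - t \<le> d_hat \<K> A"
    unfolding d_hat_def[of \<K> A]
  proof (rule cInf_greatest)
    show "{\<epsilon>. \<epsilon> > 0 \<and> (\<exists>R. is_correspondence \<epsilon> \<K> A R)} \<noteq> {}" using ex by auto
    fix \<epsilon> assume "\<epsilon> \<in> {\<epsilon>. \<epsilon> > 0 \<and> (\<exists>R. is_correspondence \<epsilon> \<K> A R)}"
    then obtain R where "\<epsilon> > 0" "is_correspondence \<epsilon> \<K> A R" by auto
    then have "\<epsilon> + t \<in> {\<epsilon>. \<epsilon> > 0 \<and> (\<exists>R. is_correspondence \<epsilon> \<K> B R)}"
      using is_correspondence_relcomp[OF _ S, of \<epsilon> \<K> R] t by auto
    then have "d_hat \<K> B \<le> \<epsilon> + t"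
      unfolding d_hat_def by (rule cInf_lower) (auto intro!: bdd_belowI[of _ 0])
    then show "d_hat \<K> B - t \<le> \<epsilon>" by simp
  qed
  then show ?thesis by simp
qed

section \<open>Intervals as unions of two boxes\<close>

lemma two_minimal_points:
  fixes I :: "(real \<times> real) set"
  assumes "card (minimal_points I) = 2"
  obtains \<xi>\<^sub>1 \<eta>\<^sub>1 \<xi>\<^sub>2 \<eta>\<^sub>2
  where "\<xi>\<^sub>1 < \<xi>\<^sub>2" "\<eta>\<^sub>1 > \<eta>\<^sub>2" "minimal_points I = {(\<xi>\<^sub>1, \<eta>\<^sub>1), (\<xi>\<^sub>2, \<eta>\<^sub>2)}"
proof -
  obtain p q where pq: "minimal_points I = {p, q}" "p \<noteq> q"
    using assms by (auto simp: card_2_iff)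
  obtain p1 p2 q1 q2 where [simp]: "p = (p1, p2)" "q = (q1, q2)" by fastforce
  have "p \<in> minimal_points I" "q \<in> minimal_points I" using pq by auto
  then have "\<not> p < q" "\<not> q < p" by (auto simp: minimal_points_def)
  then have "p1 < q1 \<and> p2 > q2 \<or> q1 < p1 \<and> q2 > p2" using pq(2) by (auto simp: less_le_not_le)
  then show thesis
    using that[of p1 q1 q2 p2] that[of q1 p1 p2 q2] pq(1) by (auto simp: insert_commute)
qed

text \<open>
  The nonnegativity of the coordinates makes both boxes nonempty. It holds because the minimal
  points belong to the interval and hence lie below the only maximal point.
\<close>

lemma two_box_form:
  assumes "pq_interval 1 1 I \<or> pq_interval 2 1 I"
  obtains x y a b c d
  where "embedding I = [x, y, a, b, c, d]" "a \<ge> 0" "b \<ge> 0" "c \<ge> 0" "d \<ge> 0"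
    "I = {(x - b, y)..(x + d, y + a)} \<union> {(x, y - c)..(x + d, y + a)}"
proof -
  have "card (maximal_points I) = 1" using assms by (auto simp: pq_interval_def)
  then obtain X Y where M: "maximal_points I = {(X, Y)}"
    by (metis card_1_singletonE surj_pair)
  have I: "I = {z. \<exists>u\<in>minimal_points I. u \<le> z \<and> z \<le> (X, Y)}"
  proof -
    have "I = {z. \<exists>u\<in>minimal_points I. \<exists>v\<in>maximal_points I. u \<le> z \<and> z \<le> v}"
      using assms unfolding pq_interval_def by blast
    then show ?thesis unfolding M by simp
  qed
  have below: "u \<le> (X, Y)" if "u \<in> minimal_points I" for u
  proof -
    have "u \<in> I" using that by (simp add: minimal_points_def)
    then show ?thesis using I by blast
  qed
  from assms show thesis
  proof
    assume pq: "pq_interval 1 1 I"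
    then have "card (minimal_points I) = 1" by (simp add: pq_interval_def)
    then obtain \<xi> \<eta> where m: "minimal_points I = {(\<xi>, \<eta>)}"
      by (metis card_1_singletonE surj_pair)
    show thesis
    proof (rule that)
      show "embedding I = [\<xi>, \<eta>, Y - \<eta>, 0, 0, X - \<xi>]" using pq m M by (rule embedding_11)
      show "Y - \<eta> \<ge> 0" "X - \<xi> \<ge> 0" using below m by auto
      show "I = {(\<xi> - 0, \<eta>)..(\<xi> + (X - \<xi>), \<eta> + (Y - \<eta>))} \<union>
          {(\<xi>, \<eta> - 0)..(\<xi> + (X - \<xi>), \<eta> + (Y - \<eta>))}"
        using I unfolding m by auto
    qed simp_all
  next
    assume pq: "pq_interval 2 1 I"
    then have "card (minimal_points I) = 2" by (simp add: pq_interval_def)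
    then obtain \<xi>\<^sub>1 \<eta>\<^sub>1 \<xi>\<^sub>2 \<eta>\<^sub>2 where lt: "\<xi>\<^sub>1 < \<xi>\<^sub>2" "\<eta>\<^sub>1 > \<eta>\<^sub>2"
      and m: "minimal_points I = {(\<xi>\<^sub>1, \<eta>\<^sub>1), (\<xi>\<^sub>2, \<eta>\<^sub>2)}"
      by (rule two_minimal_points)
    show thesis
    proof (rule that)
      show "embedding I = [\<xi>\<^sub>2, \<eta>\<^sub>1, Y - \<eta>\<^sub>1, \<xi>\<^sub>2 - \<xi>\<^sub>1, \<eta>\<^sub>1 - \<eta>\<^sub>2, X - \<xi>\<^sub>2]"
        using pq lt m M by (rule embedding_21)
      show "Y - \<eta>\<^sub>1 \<ge> 0" "X - \<xi>\<^sub>2 \<ge> 0" using below[of "(\<xi>\<^sub>1, \<eta>\<^sub>1)"] below[of "(\<xi>\<^sub>2, \<eta>\<^sub>2)"] m by auto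
      show "\<xi>\<^sub>2 - \<xi>\<^sub>1 \<ge> 0" "\<eta>\<^sub>1 - \<eta>\<^sub>2 \<ge> 0" using lt by auto
      show "I = {(\<xi>\<^sub>2 - (\<xi>\<^sub>2 - \<xi>\<^sub>1), \<eta>\<^sub>1)..(\<xi>\<^sub>2 + (X - \<xi>\<^sub>2), \<eta>\<^sub>1 + (Y - \<eta>\<^sub>1))} \<union>
          {(\<xi>\<^sub>2, \<eta>\<^sub>1 - (\<eta>\<^sub>1 - \<eta>\<^sub>2))..(\<xi>\<^sub>2 + (X - \<xi>\<^sub>2), \<eta>\<^sub>1 + (Y - \<eta>\<^sub>1))}"
        using I unfolding m by auto
    qed
  qed
qed

section \<open>Stability of intervals in their coordinates\<close>

text \<open>
  Clamping both coordinates moves a point of the first box into the second, by at most \<open>e\<close>. The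
  clamped point is sure to lie in the second box only if that box is nonempty.
\<close>

lemma box_subset_thickening:
  fixes p q r s :: real
  assumes "p' \<le> r'" "q' \<le> s'"
    and "\<bar>p - p'\<bar> \<le> e" "\<bar>q - q'\<bar> \<le> e" "\<bar>r - r'\<bar> \<le> e" "\<bar>s - s'\<bar> \<le> e"
  shows "{(p, q)..(r, s)} \<subseteq> thickening e {(p', q')..(r', s')}"
proof
  fix z assume "z \<in> {(p, q)..(r, s)}"
  then obtain z1 z2 where z: "z = (z1, z2)" "p \<le> z1" "z1 \<le> r" "q \<le> z2" "z2 \<le> s"
    by (cases z) auto
  define w1 w2 where "w1 = max p' (min z1 r')" and "w2 = max q' (min z2 s')"
  have "(w1, w2) \<in> {(p', q')..(r', s')}" using assms by (auto simp: w1_def w2_def)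
  moreover have "\<bar>w1 - z1\<bar> \<le> e" "\<bar>w2 - z2\<bar> \<le> e"
    using assms z unfolding w1_def w2_def by linarith+
  then have "infnorm ((w1, w2) - z) \<le> e" using z(1) by (simp add: infnorm_Pair_le)
  ultimately show "z \<in> thickening e {(p', q')..(r', s')}" unfolding thickening_def by blast
qed

lemma subset_thickening_embedding:
  assumes I: "pq_interval 1 1 I \<or> pq_interval 2 1 I"
    and J: "pq_interval 1 1 J \<or> pq_interval 2 1 J"
    and close: "\<forall>(s, t)\<in>set (zip (embedding I) (embedding J)). \<bar>s - t\<bar> \<le> \<delta>"
  shows "I \<subseteq> thickening (2 * \<delta>) J"
proof -
  obtain x y a b c d where eI: "embedding I = [x, y, a, b, c, d]"
    and boxI: "I = {(x - b, y)..(x + d, y + a)} \<union> {(x, y - c)..(x + d, y + a)}"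
    using I by (rule two_box_form)
  obtain x' y' a' b' c' d' where eJ: "embedding J = [x', y', a', b', c', d']"
    and nonneg: "a' \<ge> 0" "b' \<ge> 0" "c' \<ge> 0" "d' \<ge> 0"
    and boxJ: "J = {(x' - b', y')..(x' + d', y' + a')} \<union> {(x', y' - c')..(x' + d', y' + a')}"
    using J by (rule two_box_form)
  have \<delta>: "\<bar>x - x'\<bar> \<le> \<delta>" "\<bar>y - y'\<bar> \<le> \<delta>" "\<bar>a - a'\<bar> \<le> \<delta>" "\<bar>b - b'\<bar> \<le> \<delta>" "\<bar>c - c'\<bar> \<le> \<delta>" "\<bar>d - d'\<bar> \<le> \<delta>"
    using close eI eJ by auto
  have "{(x - b, y)..(x + d, y + a)} \<subseteq> thickening (2 * \<delta>) {(x' - b', y')..(x' + d', y' + a')}"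
    by (rule box_subset_thickening) (use \<delta> nonneg in linarith)+
  also have "\<dots> \<subseteq> thickening (2 * \<delta>) J" unfolding boxJ by (rule thickening_mono) simp
  finally have 1: "{(x - b, y)..(x + d, y + a)} \<subseteq> thickening (2 * \<delta>) J" .
  have "{(x, y - c)..(x + d, y + a)} \<subseteq> thickening (2 * \<delta>) {(x', y' - c')..(x' + d', y' + a')}"
    by (rule box_subset_thickening) (use \<delta> nonneg in linarith)+
  also have "\<dots> \<subseteq> thickening (2 * \<delta>) J" unfolding boxJ by (rule thickening_mono) simp
  finally have 2: "{(x, y - c)..(x + d, y + a)} \<subseteq> thickening (2 * \<delta>) J" .
  show ?thesis using 1 2 unfolding boxI by simp
qed

lemma length_embedding:
  assumes "pq_interval 1 1 I \<or> pq_interval 2 1 I"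
  shows "length (embedding I) = 6"
  using assms by (rule two_box_form) simp

section \<open>Concatenated embeddings and correspondences\<close>

lemma linf_norm_ge:
  "t \<in> set v \<Longrightarrow> \<bar>t\<bar> \<le> linf_norm v"
  by (simp add: linf_norm_def)

text \<open>
  When corresponding blocks have equal lengths, their entries stay aligned in the concatenations. A
  bound on all entries of a difference of concatenated embeddings thus holds for each pair of
  intervals.
\<close>

lemma zip_block_subset:
  assumes "list_all2 (\<lambda>I J. length (f I) = length (g J)) Is Js" "(I, J) \<in> set (zip Is Js)"
  shows "set (zip (f I) (g J)) \<subseteq> set (zip (concat (map f Is)) (concat (map g Js)))"
  using assms by (induction rule: list_all2_induct) auto

lemma is_correspondence_zip:
  assumes len: "length Is = length Js"
    and Is: "\<forall>I\<in>set Is. pq_interval 1 1 I \<or> pq_interval 2 1 I"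
    and Js: "\<forall>J\<in>set Js. pq_interval 1 1 J \<or> pq_interval 2 1 J"
    and \<delta>: "\<delta> = linf_norm (map2 (-) (concat_embedding Is) (concat_embedding Js))"
  shows "is_correspondence (2 * \<delta>) (set Is) (set Js) (set (zip Is Js))"
  unfolding is_correspondence_def
proof (intro conjI)
  show "set (zip Is Js) \<subseteq> set Is \<times> set Js" by (auto dest: set_zip_leftD set_zip_rightD)
  show "fst ` set (zip Is Js) = set Is" "snd ` set (zip Is Js) = set Js"
    using len by (simp_all flip: set_map)
  have blocks: "list_all2 (\<lambda>I J. length (embedding I) = length (embedding J)) Is Js"
    using len Is Js by (auto simp: list_all2_conv_all_nth length_embedding)
  show "\<forall>(I, J)\<in>set (zip Is Js). J \<subseteq> thickening (2 * \<delta>) I \<and> I \<subseteq> thickening (2 * \<delta>) J"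
  proof (clarify, intro conjI)
    fix I J assume IJ: "(I, J) \<in> set (zip Is Js)"
    have I: "pq_interval 1 1 I \<or> pq_interval 2 1 I" using Is IJ by (auto dest: set_zip_leftD)
    have J: "pq_interval 1 1 J \<or> pq_interval 2 1 J" using Js IJ by (auto dest: set_zip_rightD)
    have close: "\<bar>s - t\<bar> \<le> \<delta>" if "(s, t) \<in> set (zip (embedding I) (embedding J))" for s t
    proof -
      have "(s, t) \<in> set (zip (concat_embedding Is) (concat_embedding Js))"
        using zip_block_subset[OF blocks IJ] that unfolding concat_embedding_def by blast
      then have "s - t \<in> set (map2 (-) (concat_embedding Is) (concat_embedding Js))" by force
      then show ?thesis unfolding \<delta> by (rule linf_norm_ge)
    qed
    show "I \<subseteq> thickening (2 * \<delta>) J" using I J close by (intro subset_thickening_embedding) auto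
    have "\<bar>t - s\<bar> \<le> \<delta>" if "(t, s) \<in> set (zip (embedding J) (embedding I))" for s t
    proof -
      have "(s, t) \<in> set (zip (embedding I) (embedding J))" using that by (auto simp: set_zip)
      then show ?thesis using close[of s t] by (simp add: abs_minus_commute)
    qed
    then show "J \<subseteq> thickening (2 * \<delta>) I" using I J by (intro subset_thickening_embedding) auto
  qed
qed

theorem theorem14:
  fixes \<K> :: "(real \<times> real) set set"
    and \<J>\<^sub>1 \<J>\<^sub>2 :: "(real \<times> real) set list"
    and n :: nat
  assumes "finite \<K>" and "\<K> \<noteq> {}"
    and "\<forall>I\<in>\<K>. pq_interval 1 1 I \<or> pq_interval 2 1 I"
    and "n > 0"
    and "length \<J>\<^sub>1 = n" and "distinct \<J>\<^sub>1"
    and "\<forall>J\<in>set \<J>\<^sub>1. pq_interval 1 1 J \<or> pq_interval 2 1 J"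
    and "length \<J>\<^sub>2 = n" and "distinct \<J>\<^sub>2"
    and "\<forall>J\<in>set \<J>\<^sub>2. pq_interval 1 1 J \<or> pq_interval 2 1 J"
  shows "\<bar>d_hat \<K> (set \<J>\<^sub>1) - d_hat \<K> (set \<J>\<^sub>2)\<bar> \<le>
    2 * Min {linf_norm (map2 (-) (concat_embedding (permute_list \<pi> \<J>\<^sub>1)) (concat_embedding \<J>\<^sub>2)) |\<pi>.
               \<pi> permutes {..<n}}"
proof -
  define F where "F = (\<lambda>\<pi>. linf_norm (map2 (-) (concat_embedding (permute_list \<pi> \<J>\<^sub>1))
    (concat_embedding \<J>\<^sub>2)))"
  have "Min (F ` {\<pi>. \<pi> permutes {..<n}}) \<in> F ` {\<pi>. \<pi> permutes {..<n}}"
    by (rule Min_in) (auto simp: finite_permutations intro: permutes_id)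
  then obtain \<pi> where \<pi>: "\<pi> permutes {..<n}" and Min: "Min {F \<pi> |\<pi>. \<pi> permutes {..<n}} = F \<pi>"
    by (auto simp: setcompr_eq_image)
  have set: "set (permute_list \<pi> \<J>\<^sub>1) = set \<J>\<^sub>1" using \<pi> assms by (simp add: set_permute_list)
  have corr: "is_correspondence (2 * F \<pi>) (set \<J>\<^sub>1) (set \<J>\<^sub>2) (set (zip (permute_list \<pi> \<J>\<^sub>1) \<J>\<^sub>2))"
    using is_correspondence_zip[of "permute_list \<pi> \<J>\<^sub>1" \<J>\<^sub>2 "F \<pi>"] assms set by (simp add: F_def)
  \<comment> \<open>The maximum over an empty list of entries has no known sign, so the norm is nonnegative
    only because \<open>n > 0\<close> provides an entry.\<close>
  have "concat_embedding L \<noteq> []"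
    if "length L = n" "\<forall>J\<in>set L. pq_interval 1 1 J \<or> pq_interval 2 1 J" for L
    using that \<open>n > 0\<close> length_embedding[of "hd L"] by (cases L) (auto simp: concat_embedding_def)
  then have "map2 (-) (concat_embedding (permute_list \<pi> \<J>\<^sub>1)) (concat_embedding \<J>\<^sub>2) \<noteq> []"
    using assms set by (simp add: zip_eq_Nil_iff)
  then have "hd (map2 (-) (concat_embedding (permute_list \<pi> \<J>\<^sub>1)) (concat_embedding \<J>\<^sub>2)) \<in>
      set (map2 (-) (concat_embedding (permute_list \<pi> \<J>\<^sub>1)) (concat_embedding \<J>\<^sub>2))"
    by (rule hd_in_set)
  from linf_norm_ge[OF this] have nonneg: "0 \<le> 2 * F \<pi>" unfolding F_def by linarith
  have ex: "\<exists>\<epsilon>>0. \<exists>R. is_correspondence \<epsilon> \<K> (set \<J>) R"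
    if "length \<J> = n" "\<forall>J\<in>set \<J>. pq_interval 1 1 J \<or> pq_interval 2 1 J" for \<J>
  proof -
    have "I \<noteq> {} \<and> bounded I" if "pq_interval p q I" for p q I
      using that bounded_pq_interval[OF that] by (simp add: pq_interval_def poset_interval_def)
    then have "\<forall>I\<in>\<K> \<union> set \<J>. I \<noteq> {} \<and> bounded I" using that(2) assms(3) by blast
    moreover have "set \<J> \<noteq> {}" using that(1) \<open>n > 0\<close> by auto
    ultimately have "\<exists>\<epsilon>>0. is_correspondence \<epsilon> \<K> (set \<J>) (\<K> \<times> set \<J>)"
      using assms(1,2) by (intro correspondence_exists) auto
    then show ?thesis by blast
  qed
  have "d_hat \<K> (set \<J>\<^sub>2) \<le> d_hat \<K> (set \<J>\<^sub>1) + 2 * F \<pi>"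
    using assms by (intro d_hat_le_add[OF ex corr nonneg])
  moreover have "d_hat \<K> (set \<J>\<^sub>1) \<le> d_hat \<K> (set \<J>\<^sub>2) + 2 * F \<pi>"
    using assms by (intro d_hat_le_add[OF ex is_correspondence_converse[OF corr] nonneg])
  ultimately have "\<bar>d_hat \<K> (set \<J>\<^sub>1) - d_hat \<K> (set \<J>\<^sub>2)\<bar> \<le> 2 * Min {F \<pi> |\<pi>. \<pi> permutes {..<n}}"
    unfolding Min by linarith
  then show ?thesis unfolding F_def .
qed

end
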